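(* For a permutation $\rho$ define $\mathrm{fix}(\rho)=|\{i:\rho(i)=i\}|$, $\mathrm{exc}(\rho)=|\{i:\rho(i)>i\}|$, $\mathrm{fix}_{-1}(\rho)=|\{i:\rho(i)=i-1\}|$, $\mathrm{def}(\rho)=|\{i:\rho(i)<i\}|$. Then for any $\pi\in\mathfrak D^2_{2n}(3142)$ and $\sigma=\phi(\pi)\in\mathfrak S_n$, where $\phi(\pi)=\frac12\pi_{ev}$ is the permutation obtained by taking the subsequence of even values of $\pi$ and dividing all of its entries by $2$, we have \[ \mathrm{fix}(\pi)+\mathrm{fix}_{-1}(\pi)=n,\qquad \mathrm{fix}(\pi)=\mathrm{def}(\sigma),\qquad \mathrm{fix}_{-1}(\pi)=\mathrm{exc}(\sigma)+\mathrm{fix}(\sigma), \] and $\mathrm{fix}(\sigma)$ equals the number of 2-cycles in $\pi$.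
   Context: A permutation $\sigma\in\mathfrak S_N$ contains a pattern $\tau\in\mathfrak S_k$ if there are positions $i_1<\dots<i_k$ such that $(\sigma(i_1),\dots,\sigma(i_k))$ is order-isomorphic to $\tau$; otherwise $\sigma$ avoids $\tau$. A Dumont permutation of the second kind is a permutation $\pi\in\mathfrak S_{2n}$ such that $\pi(2i)<2i$ and $\pi(2i-1)\ge 2i-1$ for every $i=1,\dots,n$. $\mathfrak D^2_{2n}$ is the set of these, and $\mathfrak D^2_{2n}(3142)$ is the subset of those avoiding $3142$. Example of $\phi$: $\pi=61325487\mapsto \sigma=3124$. *)

theory Defs
  imports "HOL-Combinatorics.Permutations" "HOL-Combinatorics.Orbits"
begin

(* Elements of S_N are functions p :: nat => nat with p permutes {1..N}; such a function is the
   identity outside {1..N}, so every statistic below has to be restricted to {1..N}. *)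

(* One-line notation: the word [w_1, ..., w_k] denotes i |-> w_i on {1..k}, extended by the
   identity. *)
definition of_word :: "nat list \<Rightarrow> nat \<Rightarrow> nat" where
  "of_word w i = (if i \<in> {1..length w} then w ! (i - 1) else i)"

definition contains_pattern ::
    "nat \<Rightarrow> (nat \<Rightarrow> nat) \<Rightarrow> nat \<Rightarrow> (nat \<Rightarrow> nat) \<Rightarrow> bool" where
  "contains_pattern N p k t \<longleftrightarrow>
     (\<exists>pos. pos ` {1..k} \<subseteq> {1..N} \<and> strict_mono_on {1..k} pos \<and>
        (\<forall>a\<in>{1..k}. \<forall>b\<in>{1..k}. p (pos a) < p (pos b) \<longleftrightarrow> t a < t b))"

definition avoids_pattern ::
    "nat \<Rightarrow> (nat \<Rightarrow> nat) \<Rightarrow> nat \<Rightarrow> (nat \<Rightarrow> nat) \<Rightarrow> bool" where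
  "avoids_pattern N p k t \<longleftrightarrow> \<not> contains_pattern N p k t"

(* Dumont permutations of the second kind of {1..2n}; the parameter is n, not 2n. *)
definition dumont2 :: "nat \<Rightarrow> (nat \<Rightarrow> nat) set" where
  "dumont2 n = {p. p permutes {1..2 * n} \<and>
     (\<forall>i\<in>{1..n}. p (2 * i) < 2 * i \<and> p (2 * i - 1) \<ge> 2 * i - 1)}"

definition dumont2_avoiding_3142 :: "nat \<Rightarrow> (nat \<Rightarrow> nat) set" where
  "dumont2_avoiding_3142 n = {p \<in> dumont2 n. avoids_pattern (2 * n) p 4 (of_word [3, 1, 4, 2])}"

definition fix_count :: "nat \<Rightarrow> (nat \<Rightarrow> nat) \<Rightarrow> nat" where
  "fix_count N p = card {i \<in> {1..N}. p i = i}"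

definition exc_count :: "nat \<Rightarrow> (nat \<Rightarrow> nat) \<Rightarrow> nat" where
  "exc_count N p = card {i \<in> {1..N}. p i > i}"

(* Truncated subtraction is harmless here, since i >= 1. *)
definition fix_minus_one_count :: "nat \<Rightarrow> (nat \<Rightarrow> nat) \<Rightarrow> nat" where
  "fix_minus_one_count N p = card {i \<in> {1..N}. p i = i - 1}"

definition def_count :: "nat \<Rightarrow> (nat \<Rightarrow> nat) \<Rightarrow> nat" where
  "def_count N p = card {i \<in> {1..N}. p i < i}"

definition two_cycle_count :: "nat \<Rightarrow> (nat \<Rightarrow> nat) \<Rightarrow> nat" where
  "two_cycle_count N p = card {S. S \<subseteq> {1..N} \<and> cyclic_on p S \<and> card S = 2}"

definition phi :: "nat \<Rightarrow> (nat \<Rightarrow> nat) \<Rightarrow> nat \<Rightarrow> nat" where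
  "phi n p = of_word (map (\<lambda>x. x div 2) (filter even (map p [1..<2 * n + 1])))"

lemma phi_example: "phi 4 (of_word [6, 1, 3, 2, 5, 4, 8, 7]) = of_word [3, 1, 2, 4]"
proof -
  have "map (of_word [6, 1, 3, 2, 5, 4, 8, 7]) [1..<2 * 4 + 1] = [6, 1, 3, 2, 5, 4, 8, 7]"
    by (simp add: of_word_def upt_rec)
  then show ?thesis
    by (simp only: phi_def) simp
qed

end

theory Submission
  imports Defs
begin

text \<open>Avoiding 3142 pins down the odd values: each value 2i-1 sits at position 2i-1 or 2i
  (\<open>dumont2_avoiding_3142_odd_values\<close>). This is proved by strong induction on the
  length of a block of positions (\<open>odd_values_near_diagonal_in_block\<close>):
  \<open>not_3142\<close> forces small values to precede large ones, and
  \<open>split_at_threshold\<close> turns this into a decomposition into shorter blocks.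

  Consequently each pair of positions 2i-1, 2i carries exactly one even value, namely 2\<sigma>(i).
  If it stands at 2i, then 2i-1 is a fixed point and the Dumont condition gives \<sigma>(i) < i. If
  it stands at 2i-1, then \<pi>(2i) = 2i-1 and 2\<sigma>(i) \<ge> 2i-1, so \<sigma>(i) \<ge> i. The
  Dumont conditions allow no fixed point at an even position and no \<pi>(x) = x-1 at an odd one, so
  the first three identities follow by counting. The smaller element of a 2-cycle is an exceedance
  of \<pi>, hence an odd position 2i-1 that is not fixed; its partner must be 2i, which means
  \<sigma>(i) = i.\<close>

section \<open>Initial segments and splitting at a threshold\<close>

lemma lower_segment_interval:
  fixes S :: "nat set"
  assumes "S \<subseteq> {l..<h}" and "\<And>x y. x \<in> {l..<h} \<Longrightarrow> y \<in> S \<Longrightarrow> x < y \<Longrightarrow> x \<in> S"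
  shows "S = {l..<l + card S}"
proof (cases "S = {}")
  case False
  have fin: "finite S" using assms(1) finite_subset by blast
  have "S = {l..<Suc (Max S)}"
  proof
    show "S \<subseteq> {l..<Suc (Max S)}"
      using assms(1) fin by (auto simp: less_Suc_eq_le)
    show "{l..<Suc (Max S)} \<subseteq> S"
    proof
      fix x assume x: "x \<in> {l..<Suc (Max S)}"
      have M: "Max S \<in> S" using fin False by simp
      show "x \<in> S"
      proof (cases "x = Max S")
        case True
        then show ?thesis using M by simp
      next
        case False
        then show ?thesis using x M assms(1) by (intro assms(2)[of x "Max S"]) auto
      qed
    qed
  qed
  moreover have "l \<le> Max S" using Max_in[OF fin False] assms(1) by auto
  ultimately show ?thesis
    by (metis add_diff_inverse_nat card_atLeastLessThan le_SucI not_less)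
qed simp

text \<open>By \<open>sep\<close> the positions with values below \<open>v\<close> form an initial
  segment, and as their values fill \<open>{L..<v}\<close> there are \<open>v - L\<close> of them.
  So the cut is at \<open>l + (v - L)\<close>; it is named \<open>m\<close> to let callers choose
  its form.\<close>

lemma split_at_threshold:
  fixes f :: "nat \<Rightarrow> nat"
  assumes inj: "inj_on f {l..<h}" and img: "f ` {l..<h} \<inter> {..<v} = {L..<v}" "L \<le> v"
    and sep: "\<forall>x\<in>{l..<h}. \<forall>y\<in>{l..<h}. x < y \<longrightarrow> f y < v \<longrightarrow> f x < v"
    and eq: "m = l + (v - L)"
  shows "f ` {l..<m} = {L..<v}" and "f ` {m..<h} = f ` {l..<h} - {..<v}"
proof -
  define S where "S = {x \<in> {l..<h}. f x < v}"
  have "f ` S = f ` {l..<h} \<inter> {..<v}" by (auto simp: S_def)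
  then have fS: "f ` S = {L..<v}" using img(1) by simp
  moreover have "inj_on f S" using inj unfolding S_def by (rule inj_on_subset) auto
  ultimately have "card S = v - L" by (metis card_atLeastLessThan card_image)
  moreover have "x \<in> S" if "x \<in> {l..<h}" "y \<in> S" "x < y" for x y
    using sep that unfolding S_def by blast
  then have "S = {l..<l + card S}"
    by (intro lower_segment_interval[where h = h]) (auto simp: S_def)
  ultimately have S: "S = {l..<m}" using eq by simp
  then show "f ` {l..<m} = {L..<v}" using fS by simp
  have "{m..<h} = {l..<h} - S"
    using S eq by auto
  then show "f ` {m..<h} = f ` {l..<h} - {..<v}"
    unfolding S_def by (auto simp: image_iff)
qed

section \<open>The pattern 3142 and 2-cycles in usable form\<close>

lemma not_3142:
  assumes avoid: "avoids_pattern N p 4 (of_word [3, 1, 4, 2])"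
    and idx: "1 \<le> w" "w < x" "x < y" "y < z" "z \<le> N"
    and ord: "p x < p z" "p z < p w" "p w < p y"
  shows False
proof -
  have set4: "{1..4::nat} = {1, 2, 3, 4}" by auto
  define pos where "pos i = of_word [w, x, y, z] i" for i
  have pos_simps: "pos 1 = w" "pos (Suc 0) = w" "pos 2 = x" "pos 3 = y" "pos 4 = z"
    by (simp_all add: pos_def of_word_def)
  have "contains_pattern N p 4 (of_word [3, 1, 4, 2])"
    unfolding contains_pattern_def
  proof (intro exI[of _ pos] conjI)
    show "pos ` {1..4} \<subseteq> {1..N}"
      unfolding set4 using idx by (simp add: pos_simps)
    show "strict_mono_on {1..4} pos"
      unfolding set4 strict_mono_on_def using idx by (auto simp: pos_simps)
    show "\<forall>a\<in>{1..4}. \<forall>b\<in>{1..4}. (p (pos a) < p (pos b)) =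
        (of_word [3, 1, 4, 2] a < of_word [3, 1, 4, 2] b)"
      unfolding set4 using ord by (simp add: pos_simps of_word_def)
  qed
  with avoid show False by (simp add: avoids_pattern_def)
qed

text \<open>A two-element orbit is {x, f x}; injectivity rules out f (f x) = f x, so f (f x) returns
  to x.\<close>

lemma cyclic_on_card_2_iff:
  assumes "permutation f"
  shows "cyclic_on f S \<and> card S = 2 \<longleftrightarrow> (\<exists>x. f x \<noteq> x \<and> f (f x) = x \<and> S = {x, f x})"
proof
  assume S: "cyclic_on f S \<and> card S = 2"
  then obtain x where x: "x \<in> S" "S = orbit f x" by (auto simp: cyclic_on_def)
  have "f x \<in> S" using x by (simp add: orbit.base)
  have "f (f x) \<in> S" using x by (simp add: orbit.base orbit.step)
  have ne: "f x \<noteq> x"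
  proof
    assume "f x = x"
    then have "S = {x}" using x(2) by (simp add: orbit_eq_singleton_iff)
    then show False using S by simp
  qed
  have "finite S" using S card.infinite by fastforce
  then have Seq: "S = {x, f x}"
    using S x(1) \<open>f x \<in> S\<close> ne by (intro card_subset_eq[symmetric]) auto
  have "f (f x) \<noteq> f x"
    using assms ne by (metis permutation_bijective bij_def injD)
  then have "f (f x) = x" using \<open>f (f x) \<in> S\<close> Seq by auto
  then show "\<exists>x. f x \<noteq> x \<and> f (f x) = x \<and> S = {x, f x}" using ne Seq by blast
next
  assume "\<exists>x. f x \<noteq> x \<and> f (f x) = x \<and> S = {x, f x}"
  then obtain x where x: "f x \<noteq> x" "f (f x) = x" "S = {x, f x}" by blast
  have "y \<in> S" if "y \<in> orbit f x" for y
    using that by induction (use x in auto)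
  moreover have "x \<in> orbit f x"
    using orbit.step[OF orbit.base, of f x] x(2) by simp
  ultimately have "S = orbit f x" using x orbit.base[of f x] by auto
  then have "cyclic_on f S" using x by (auto simp: cyclic_on_def)
  then show "cyclic_on f S \<and> card S = 2" using x by simp
qed

section \<open>Positions of the odd values\<close>

text \<open>
  Blocks of even length are of two kinds: those mapped onto themselves, and those whose values are
  the positions shifted down by one. The values at the first (respectively last) two positions are
  \<open>e, 2a+1\<close> (respectively \<open>2b-1, e\<close>), so avoiding 3142 forces all values below \<open>e\<close> to precede those
  above it; as \<open>e\<close> is even, this splits off two shorter blocks, one of each kind.
\<close>

lemma odd_values_near_diagonal_in_block:
  fixes p :: "nat \<Rightarrow> nat"
  assumes inj: "inj p"
    and even: "\<And>i. 1 \<le> i \<Longrightarrow> i \<le> n \<Longrightarrow> p (2 * i) < 2 * i"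
    and odd: "\<And>i. 1 \<le> i \<Longrightarrow> i \<le> n \<Longrightarrow> p (2 * i - 1) \<ge> 2 * i - 1"
    and avoid: "avoids_pattern (2 * n) p 4 (of_word [3, 1, 4, 2])"
    and "a \<le> b" "b \<le> n"
    and "p ` {2*a+1..<2*b+1} = {2*a+1..<2*b+1} \<or> p ` {2*a+1..<2*b+1} = {2*a..<2*b}"
    and "a < i" "i \<le> b"
  shows "p (2 * i - 1) = 2 * i - 1 \<or> p (2 * i) = 2 * i - 1"
  using assms(5-)
proof (induction "b - a" arbitrary: a b rule: less_induct)
  case less
  have injD: "x = y" if "p x = p y" for x y using inj that by (meson injD)
  have injS: "inj_on p A" for A using inj by (rule inj_on_subset) simp
  have oddv: "v \<le> p v" if "odd v" "v \<le> 2 * n" for v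
  proof -
    from that obtain k where "v = 2 * k + 1" using oddE by blast
    then show ?thesis using odd[of "k + 1"] that by simp
  qed
  have ab: "a < b" using less.prems by simp
  from less.prems(3) show ?case
  proof
    assume P: "p ` {2*a+1..<2*b+1} = {2*a+1..<2*b+1}"
    \<comment> \<open>The Dumont bound p(2a+2) < 2a+2 leaves only the least value of the
      block.\<close>
    have "p (2*a+2) \<in> {2*a+1..<2*b+1}" using ab by (subst P[symmetric]) auto
    then have p2: "p (2*a+2) = 2*a+1" using even[of "a+1"] ab less.prems by simp
    define e where "e = p (2*a+1)"
    have "e \<in> {2*a+1..<2*b+1}" unfolding e_def using ab by (subst P[symmetric]) auto
    moreover have "e \<noteq> 2*a+1" unfolding e_def using p2 injD[of "2*a+1" "2*a+2"] by auto
    ultimately have e: "2*a+2 \<le> e" "e \<le> 2*b" by auto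
    have img: "p ` {2*a+1..<2*b+1} \<inter> {..<e+1} = {2*a+1..<e+1}" using P e by auto
    \<comment> \<open>Otherwise positions 2a+1, 2a+2, x, y carry e, 2a+1, p x, p y with 2a+1 < p y <
      e < p x, a 3142. The threshold is e+1 because e itself belongs to the lower part.\<close>
    have sep: "\<forall>x\<in>{2*a+1..<2*b+1}. \<forall>y\<in>{2*a+1..<2*b+1}. x < y \<longrightarrow> p y < e + 1 \<longrightarrow> p x < e + 1"
    proof (intro ballI impI, rule ccontr)
      fix x y
      assume that: "x \<in> {2*a+1..<2*b+1}" "y \<in> {2*a+1..<2*b+1}" "x < y" "p y < e + 1"
        and x: "\<not> p x < e + 1"
      then have "x \<noteq> 2*a+1" "x \<noteq> 2*a+2" using p2 e e_def by auto
      moreover have "p y \<noteq> e" using that \<open>x \<noteq> 2*a+1\<close> injD[of y "2*a+1"] e_def by auto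
      moreover have "p y \<noteq> 2*a+1" using that \<open>x \<noteq> 2*a+2\<close> \<open>x \<noteq> 2*a+1\<close> injD[of y "2*a+2"] p2 by auto
      moreover have "p y \<in> {2*a+1..<2*b+1}" using that by (subst P[symmetric]) auto
      ultimately show False
        using not_3142[OF avoid, of "2*a+1" "2*a+2" x y] that x p2 less.prems e_def by auto
    qed
    note split = split_at_threshold[OF injS img _ sep, where m = "e + 1"]
    have low: "p ` {2*a+1..<e+1} = {2*a+1..<e+1}" using split(1) e by auto
    have high: "p ` {e+1..<2*b+1} = {e+1..<2*b+1}" using split(2) e P by auto
    \<comment> \<open>If e were odd, then p e \<ge> e, while the lower part is mapped onto itself
      with maximum e; so p e = e, although e is already the value at 2a+1.\<close>
    have "even e"
    proof (rule ccontr)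
      assume "odd e"
      then have "e \<le> p e" using oddv e less.prems by simp
      moreover have "p e \<in> {2*a+1..<e+1}" using e by (subst low[symmetric]) auto
      moreover have "p e \<noteq> e" using injD[of e "2*a+1"] e e_def by auto
      ultimately show False by auto
    qed
    then obtain k where k: "e = 2 * k" by auto
    \<comment> \<open>Deleting the first two positions, with values e and 2a+1, leaves a block of
      the shifted kind.\<close>
    have "{2*(a+1)+1..<2*k+1} = {2*a+1..<e+1} - {2*a+1, 2*a+2}" using e k by auto
    then have "p ` {2*(a+1)+1..<2*k+1} = p ` {2*a+1..<e+1} - p ` {2*a+1, 2*a+2}"
      using inj by (simp add: image_set_diff)
    also have "\<dots> = {2*a+1..<e+1} - {e, 2*a+1}" using low p2 e_def by simp
    also have "\<dots> = {2*(a+1)..<2*k}" using e k by auto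
    finally have Q: "p ` {2*(a+1)+1..<2*k+1} = {2*(a+1)..<2*k}" .
    consider "i = a + 1" | "a + 1 < i" "i \<le> k" | "k < i" using less.prems by linarith
    then show ?thesis
    proof cases
      case 1
      then show ?thesis using p2 by simp
    next
      case 2
      then show ?thesis using less.hyps[of k "a+1"] Q e k less.prems by auto
    next
      case 3
      then show ?thesis using less.hyps[of b k] high e k less.prems by auto
    qed
  next
    assume Q: "p ` {2*a+1..<2*b+1} = {2*a..<2*b}"
    \<comment> \<open>Dually, p(2b-1) \<ge> 2b-1 leaves only the greatest value of the
      block.\<close>
    have "p (2*b-1) \<in> {2*a..<2*b}" using ab by (subst Q[symmetric], intro imageI) auto
    then have p1: "p (2*b-1) = 2*b-1" using odd[of b] ab less.prems(2) by (intro antisym) auto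
    define e where "e = p (2*b)"
    have "e \<in> {2*a..<2*b}" unfolding e_def using ab by (subst Q[symmetric]) auto
    moreover have "e \<noteq> 2*b-1" using p1 injD[of "2*b" "2*b-1"] e_def ab by auto
    ultimately have e: "2*a \<le> e" "e < 2*b-1" by auto
    have "{2*a+1..<2*b-1} = {2*a+1..<2*b+1} - {2*b-1, 2*b}" using ab by auto
    then have "p ` {2*a+1..<2*b-1} = p ` {2*a+1..<2*b+1} - p ` {2*b-1, 2*b}"
      using inj by (simp add: image_set_diff)
    also have "\<dots> = {2*a..<2*b} - {2*b-1, e}" using Q p1 e_def by simp
    also have "\<dots> = {2*a..<2*b-1} - {e}" using e by auto
    finally have I: "p ` {2*a+1..<2*b-1} = {2*a..<2*b-1} - {e}" .
    have img: "p ` {2*a+1..<2*b-1} \<inter> {..<e} = {2*a..<e}" using I e by auto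
    \<comment> \<open>Here the last two positions play 4 and 2: the values p x, p y, 2b-1, e at x,
      y, 2b-1, 2b would form a 3142. The threshold is e, since e is no longer among the remaining
      values; the shift of the values still puts the cut at position e+1.\<close>
    have sep: "\<forall>x\<in>{2*a+1..<2*b-1}. \<forall>y\<in>{2*a+1..<2*b-1}. x < y \<longrightarrow> p y < e \<longrightarrow> p x < e"
    proof (intro ballI impI, rule ccontr)
      fix x y
      assume that: "x \<in> {2*a+1..<2*b-1}" "y \<in> {2*a+1..<2*b-1}" "x < y" "p y < e"
        and x: "\<not> p x < e"
      have "p x \<in> {2*a..<2*b-1} - {e}" using that by (subst I[symmetric]) auto
      then show False
        using not_3142[OF avoid, of x y "2*b-1" "2*b"] that x p1 less.prems e_def by auto
    qed
    note split = split_at_threshold[OF injS img _ sep, where m = "e + 1"]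
    have low: "p ` {2*a+1..<e+1} = {2*a..<e}" using split(1) e by auto
    have high: "p ` {e+1..<2*b-1} = {e+1..<2*b-1}" using split(2) e I by auto
    \<comment> \<open>An odd e would be a position of the lower block with p e \<ge> e, but all
      values there are below e.\<close>
    have "even e"
    proof (rule ccontr)
      assume "odd e"
      then have "e \<le> p e" using oddv e less.prems by simp
      moreover have "2*a+1 \<le> e" using \<open>odd e\<close> e by presburger
      then have "p e \<in> {2*a..<e}" by (subst low[symmetric]) auto
      ultimately show False by auto
    qed
    then obtain k where k: "e = 2 * k" by auto
    have "2*(b-1)+1 = 2*b-1" using ab by simp
    then have high': "p ` {2*k+1..<2*(b-1)+1} = {2*k+1..<2*(b-1)+1}"
      using high k by simp
    consider "i = b" | "i \<le> k" | "k < i" "i \<le> b - 1" using less.prems by linarith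
    then show ?thesis
    proof cases
      case 1
      then show ?thesis using p1 by simp
    next
      case 2
      then show ?thesis using less.hyps[of k a] low e k less.prems by auto
    next
      case 3
      then show ?thesis using less.hyps[of "b-1" k] high' e k less.prems by auto
    qed
  qed
qed

text \<open>All positions together form a block mapped onto itself, with a = 0 and b = n.\<close>

lemma dumont2_avoiding_3142_odd_values:
  assumes "p \<in> dumont2_avoiding_3142 n" "1 \<le> i" "i \<le> n"
  shows "p (2 * i - 1) = 2 * i - 1 \<or> p (2 * i) = 2 * i - 1"
proof -
  have perm: "p permutes {1..2 * n}"
    and dumont: "\<And>i. 1 \<le> i \<Longrightarrow> i \<le> n \<Longrightarrow> p (2 * i) < 2 * i"
      "\<And>i. 1 \<le> i \<Longrightarrow> i \<le> n \<Longrightarrow> p (2 * i - 1) \<ge> 2 * i - 1"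
    and avoid: "avoids_pattern (2 * n) p 4 (of_word [3, 1, 4, 2])"
    using assms(1) by (auto simp: dumont2_avoiding_3142_def dumont2_def)
  have "{2*0+1..<2*n+1} = {1..2*n}" by auto
  then have "p ` {2*0+1..<2*n+1} = {2*0+1..<2*n+1}"
    using permutes_image[OF perm] by simp
  then show ?thesis
    using odd_values_near_diagonal_in_block[OF permutes_inj[OF perm] dumont avoid, of 0 n i] assms
    by simp
qed

section \<open>Transfer of the statistics from \<pi> to \<sigma>\<close>

theorem theorem3p1:
  fixes n :: nat and \<pi> \<sigma> :: "nat \<Rightarrow> nat"
  assumes "\<pi> \<in> dumont2_avoiding_3142 n"
    and "\<sigma> = phi n \<pi>"
  shows "\<sigma> permutes {1..n} \<and>
    fix_count (2 * n) \<pi> + fix_minus_one_count (2 * n) \<pi> = n \<and>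
    fix_count (2 * n) \<pi> = def_count n \<sigma> \<and>
    fix_minus_one_count (2 * n) \<pi> = exc_count n \<sigma> + fix_count n \<sigma> \<and>
    fix_count n \<sigma> = two_cycle_count (2 * n) \<pi>"
proof -
  have perm: "\<pi> permutes {1..2 * n}"
    and lt: "\<And>i. 1 \<le> i \<Longrightarrow> i \<le> n \<Longrightarrow> \<pi> (2 * i) < 2 * i"
    and ge: "\<And>i. 1 \<le> i \<Longrightarrow> i \<le> n \<Longrightarrow> \<pi> (2 * i - 1) \<ge> 2 * i - 1"
    using assms(1) by (auto simp: dumont2_avoiding_3142_def dumont2_def)
  note pair = dumont2_avoiding_3142_odd_values[OF assms(1)]
  have inj: "x = y" if "\<pi> x = \<pi> y" for x y
    using permutes_inj[OF perm] that by (meson injD)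
  have range: "\<pi> x \<in> {1..2*n}" if "x \<in> {1..2*n}" for x
    using permutes_in_image[OF perm] that by blast
  have posE: thesis
    if "x \<in> {1..2*n}" "\<And>i. i \<in> {1..n} \<Longrightarrow> x = 2*i - 1 \<Longrightarrow> thesis"
      "\<And>i. i \<in> {1..n} \<Longrightarrow> x = 2*i \<Longrightarrow> thesis" for x thesis
  proof (cases "even x")
    case True
    then obtain i where "x = 2 * i" by auto
    then show thesis using that by auto
  next
    case False
    then obtain i where "x = 2 * i + 1" using oddE by blast
    then show thesis using that(1) that(2)[of "i+1"] by auto
  qed
  have odd_value: "x = \<pi> x \<or> x = \<pi> x + 1" if x: "x \<in> {1..2*n}" "odd (\<pi> x)" for x
  proof -
    obtain i where i: "i \<in> {1..n}" "\<pi> x = 2*i - 1"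
      by (rule posE[OF range[OF x(1)]]) (use x in auto)
    then have "\<pi> (2*i - 1) = \<pi> x \<or> \<pi> (2*i) = \<pi> x" using pair[of i] by auto
    then have "2*i - 1 = x \<or> 2*i = x" using inj by blast
    then show ?thesis using i by auto
  qed

  \<comment> \<open>The position among \<open>2i-1\<close>, \<open>2i\<close> that does not carry \<open>2i-1\<close>; its value is \<open>2\<sigma>(i)\<close>.\<close>
  define h where "h i = (if \<pi> (2*i - 1) = 2*i - 1 then 2*i else 2*i - 1)" for i
  \<comment> \<open>An odd value at \<open>h i\<close> could only be 2i-1, which by the choice of
    \<open>h\<close> is carried by the other position of the pair.\<close>
  have even_h: "even (\<pi> (h i))" if "i \<in> {1..n}" for i
  proof (rule ccontr)
    assume odd: "odd (\<pi> (h i))"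
    have "h i \<in> {1..2*n}" using that by (auto simp: h_def)
    from odd_value[OF this odd] show False
    proof (cases "\<pi> (2*i - 1) = 2*i - 1")
      case True
      then have "h i = 2*i" by (simp add: h_def)
      then have "\<pi> (2*i) = 2*i - 1"
        using odd_value[of "2*i"] odd that by auto
      then show False using inj[of "2*i" "2*i-1"] True that by auto
    next
      case False
      then have "h i = 2*i - 1" by (simp add: h_def)
      moreover from this have "\<pi> (2*i - 1) = 2*i - 1 \<or> \<pi> (2*i - 1) + 1 = 2*i - 1"
        using odd_value[of "2*i-1"] odd \<open>h i \<in> {1..2*n}\<close> by auto
      ultimately show False using False ge[of i] that by auto
    qed
  qed
  \<comment> \<open>Each pair of positions contributes one even value, so the filtered word is
    indexed by pairs; the general \<open>k\<close> serves the induction on prefixes.\<close>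
  have evens: "filter even (map \<pi> [1..<2*k+1]) = map (\<lambda>i. \<pi> (h i)) [1..<k+1]" if "k \<le> n" for k
    using that
  proof (induction k)
    case (Suc k)
    have "[1..<2 * Suc k + 1] = [1..<2*k+1] @ [2 * Suc k - 1, 2 * Suc k]"
      by simp
    moreover have "filter even (map \<pi> [2 * Suc k - 1, 2 * Suc k]) = [\<pi> (h (Suc k))]"
      using even_h[of "Suc k"] pair[of "Suc k"] Suc.prems by (auto simp: h_def split: if_splits)
    ultimately show ?case using Suc by simp
  qed simp
  have phi: "\<sigma> = of_word (map (\<lambda>i. \<pi> (h i) div 2) [1..<n+1])"
    unfolding assms(2) phi_def evens[OF order_refl] by (simp add: comp_def)
  have sig_out: "\<sigma> i = i" if "i \<notin> {1..n}" for i
    unfolding phi of_word_def using that by auto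
  have "\<sigma> i = \<pi> (h i) div 2" if "i \<in> {1..n}" for i
    unfolding phi of_word_def using that by (auto simp del: upt_Suc)
  then have sig: "\<pi> (h i) = 2 * \<sigma> i" if "i \<in> {1..n}" for i
    using even_h that by simp
  have h_range: "h i \<in> {1..2*n}" if "i \<in> {1..n}" for i
    using that by (auto simp: h_def)

  have sig_perm: "\<sigma> permutes {1..n}"
  proof (rule bij_imp_permutes)
    have "\<sigma> ` {1..n} \<subseteq> {1..n}"
      using sig range[OF h_range] by fastforce
    moreover have "inj_on \<sigma> {1..n}"
    proof (rule inj_onI)
      fix i j assume ij: "i \<in> {1..n}" "j \<in> {1..n}" "\<sigma> i = \<sigma> j"
      then have "\<pi> (h i) = \<pi> (h j)" using sig by simp
      then have "h i = h j" by (rule inj)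
      then show "i = j" using ij by (simp add: h_def split: if_splits)
    qed
    ultimately show "bij_betw \<sigma> {1..n} {1..n}"
      by (simp add: bij_betw_def endo_inj_surj)
  qed (use sig_out in auto)

  \<comment> \<open>The position \<open>h i\<close> decides which Dumont inequality applies to
    2\<sigma>(i): 2\<sigma>(i) < 2i at position 2i, and 2\<sigma>(i) \<ge> 2i-1 at 2i-1, where
    parity improves the bound to \<sigma>(i) \<ge> i.\<close>
  have fix_iff: "\<pi> (2*i - 1) = 2*i - 1 \<longleftrightarrow> \<sigma> i < i" if "i \<in> {1..n}" for i
    using sig[of i] lt[of i] ge[of i] that by (auto simp: h_def split: if_splits)
  have fix1_iff: "\<pi> (2*i) = 2*i - 1 \<longleftrightarrow> i \<le> \<sigma> i" if "i \<in> {1..n}" for i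
    using fix_iff[OF that] pair[of i] inj[of "2*i" "2*i-1"] that by auto

  have "{x \<in> {1..2*n}. \<pi> x = x} = (\<lambda>i. 2*i - 1) ` {i \<in> {1..n}. \<sigma> i < i}"
  proof (intro set_eqI iffI)
    fix x assume "x \<in> {x \<in> {1..2*n}. \<pi> x = x}"
    then have x: "x \<in> {1..2*n}" "\<pi> x = x" by auto
    from x(1) show "x \<in> (\<lambda>i. 2*i - 1) ` {i \<in> {1..n}. \<sigma> i < i}"
      by (rule posE) (use x lt fix_iff in fastforce)+
  qed (use fix_iff in auto)
  moreover have "inj_on (\<lambda>i::nat. 2*i - 1) {i \<in> {1..n}. \<sigma> i < i}"
    by (auto intro!: inj_onI)
  ultimately have fixed: "fix_count (2*n) \<pi> = card {i \<in> {1..n}. \<sigma> i < i}"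
    by (simp add: fix_count_def card_image)

  have "{x \<in> {1..2*n}. \<pi> x = x - 1} = (\<lambda>i. 2*i) ` {i \<in> {1..n}. i \<le> \<sigma> i}"
  proof (intro set_eqI iffI)
    fix x assume "x \<in> {x \<in> {1..2*n}. \<pi> x = x - 1}"
    then have x: "x \<in> {1..2*n}" "\<pi> x = x - 1" by auto
    from x(1) show "x \<in> (\<lambda>i. 2*i) ` {i \<in> {1..n}. i \<le> \<sigma> i}"
    proof (rule posE)
      fix i assume "i \<in> {1..n}" "x = 2*i - 1"
      then show ?thesis using x ge[of i] by auto
    next
      fix i assume "i \<in> {1..n}" "x = 2*i"
      then show ?thesis using x fix1_iff[of i] by auto
    qed
  qed (use fix1_iff in auto)
  then have shifted: "fix_minus_one_count (2*n) \<pi> = card {i \<in> {1..n}. i \<le> \<sigma> i}"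
    by (simp add: fix_minus_one_count_def card_image inj_on_def)

  have "card ({i \<in> {1..n}. \<sigma> i < i} \<union> {i \<in> {1..n}. i \<le> \<sigma> i}) =
      card {i \<in> {1..n}. \<sigma> i < i} + card {i \<in> {1..n}. i \<le> \<sigma> i}"
    by (rule card_Un_disjoint) auto
  moreover have "{i \<in> {1..n}. \<sigma> i < i} \<union> {i \<in> {1..n}. i \<le> \<sigma> i} = {1..n}" by auto
  ultimately have total: "card {i \<in> {1..n}. \<sigma> i < i} + card {i \<in> {1..n}. i \<le> \<sigma> i} = n"
    by simp
  have "card ({i \<in> {1..n}. \<sigma> i > i} \<union> {i \<in> {1..n}. \<sigma> i = i}) =
      card {i \<in> {1..n}. \<sigma> i > i} + card {i \<in> {1..n}. \<sigma> i = i}"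
    by (rule card_Un_disjoint) auto
  moreover have "{i \<in> {1..n}. \<sigma> i > i} \<union> {i \<in> {1..n}. \<sigma> i = i} = {i \<in> {1..n}. i \<le> \<sigma> i}"
    by auto
  ultimately have weak: "card {i \<in> {1..n}. i \<le> \<sigma> i} = exc_count n \<sigma> + fix_count n \<sigma>"
    by (simp add: exc_count_def fix_count_def)

  have "{S. S \<subseteq> {1..2*n} \<and> cyclic_on \<pi> S \<and> card S = 2} =
      (\<lambda>i. {2*i - 1, 2*i}) ` {i \<in> {1..n}. \<sigma> i = i}" (is "?C = ?D")
  proof (intro set_eqI iffI)
    fix S assume "S \<in> ?C"
    then obtain x where sub: "S \<subseteq> {1..2*n}" and ne: "\<pi> x \<noteq> x" and cyc: "\<pi> (\<pi> x) = x"
      and S: "S = {x, \<pi> x}"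
      using cyclic_on_card_2_iff[OF permutation_permutes[THEN iffD2]] perm by blast
    \<comment> \<open>Naming the smaller element \<open>y\<close> makes it an exceedance, which
      excludes even positions.\<close>
    have "\<exists>y. S = {y, \<pi> y} \<and> y < \<pi> y \<and> \<pi> (\<pi> y) = y"
    proof (cases "x < \<pi> x")
      case True
      then show ?thesis using S cyc by blast
    next
      case False
      then have "S = {\<pi> x, \<pi> (\<pi> x)} \<and> \<pi> x < \<pi> (\<pi> x) \<and> \<pi> (\<pi> (\<pi> x)) = \<pi> x"
        using S cyc ne by auto
      then show ?thesis by blast
    qed
    then obtain y where y: "S = {y, \<pi> y}" "y < \<pi> y" "\<pi> (\<pi> y) = y" by blast
    have "y \<in> {1..2*n}" using y sub by auto
    then obtain i where i: "i \<in> {1..n}" "y = 2*i - 1"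
      by (rule posE) (use y lt in fastforce)+
    then have "\<pi> (2*i - 1) \<noteq> 2*i - 1" using y by auto
    then have "\<pi> (2*i) = 2*i - 1" using pair[of i] i by auto
    then have "\<pi> (2*i) = \<pi> (\<pi> y)" using y i by simp
    then have \<pi>y: "\<pi> y = 2*i" using inj by metis
    have "h i = y" using i y by (simp add: h_def)
    then have "\<sigma> i = i" using sig[OF i(1)] \<pi>y by simp
    then show "S \<in> ?D" using i y \<pi>y by auto
  next
    fix S assume "S \<in> ?D"
    then obtain i where i: "i \<in> {1..n}" "\<sigma> i = i" "S = {2*i - 1, 2*i}" by auto
    have "\<pi> (2*i) = 2*i - 1" using fix1_iff i by simp
    moreover have "h i = 2*i - 1" using fix_iff[OF i(1)] i(2) by (simp add: h_def)
    then have "\<pi> (2*i - 1) = 2*i" using sig[OF i(1)] i by simp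
    ultimately have "\<exists>x. \<pi> x \<noteq> x \<and> \<pi> (\<pi> x) = x \<and> S = {x, \<pi> x}"
      using i by (intro exI[of _ "2*i - 1"]) auto
    then have "cyclic_on \<pi> S \<and> card S = 2"
      using cyclic_on_card_2_iff[OF permutation_permutes[THEN iffD2]] perm by blast
    then show "S \<in> ?C" using i by auto
  qed
  moreover have "inj_on (\<lambda>i::nat. {2*i - 1, 2*i}) {i \<in> {1..n}. \<sigma> i = i}"
    by (rule inj_onI) (auto simp: doubleton_eq_iff)
  ultimately have "fix_count n \<sigma> = two_cycle_count (2*n) \<pi>"
    by (simp add: two_cycle_count_def fix_count_def card_image)
  then show ?thesis
    using sig_perm fixed shifted total weak by (simp add: def_count_def)
qed

end
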